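(* Let $T>0$ and let $\hat\sigma(K,F)$ be an implied volatility smile satisfying the standing assumptions. If the smile is a pure function of log-moneyness, i.e. there is a function $\sigma:\mathbb R\to(0,\infty)$ with $\hat\sigma(K,F)=\sigma(\ln(K/F))$ for all $K,F>0$, then the variance swap total delta is identically zero: $$\frac{dV^*}{dF}(F)=0\qquad\text{for all }F>0.$$
   Context: Fix a maturity $T>0$. Let $N$ be the standard normal cumulative distribution function. The undiscounted Black-Scholes call and put prices with forward price $F>0$, strike $K>0$ and volatility $\varsigma>0$ are $$C_{\mathrm{BS}}(F,K,\varsigma)=FN(d_1)-KN(d_2),\qquad P_{\mathrm{BS}}(F,K,\varsigma)=KN(-d_2)-FN(-d_1),\qquad d_{1,2}=\frac{\ln(F/K)}{\varsigma\sqrt T}\pm\tfrac12\varsigma\sqrt T.$$ An implied volatility smile is a twice continuously differentiable function $\hat\sigma(K,F)>0$ of strike $K>0$ and forward $F>0$. The fair value of (annualized) variance is $$V^*(F)=\frac2T\int_0^F P_{\mathrm{BS}}\big(F,K,\hat\sigma(K,F)\big)\frac{dK}{K^2}+\frac2T\int_F^{\infty}C_{\mathrm{BS}}\big(F,K,\hat\sigma(K,F)\big)\frac{dK}{K^2},$$ and the variance swap total delta is the derivative $dV^*/dF$. Standing assumption: these integrals converge for every $F>0$. *)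

theory Defs
  imports "HOL-Probability.Probability"
begin

definition N :: "real \<Rightarrow> real" where
  "N = cdf std_normal_distribution"

definition d1 :: "real \<Rightarrow> real \<Rightarrow> real \<Rightarrow> real \<Rightarrow> real" where
  "d1 T F K v = ln (F / K) / (v * sqrt T) + v * sqrt T / 2"

definition d2 :: "real \<Rightarrow> real \<Rightarrow> real \<Rightarrow> real \<Rightarrow> real" where
  "d2 T F K v = ln (F / K) / (v * sqrt T) - v * sqrt T / 2"

(* Undiscounted Black-Scholes prices: maturity T, forward F, strike K, volatility v. *)

definition bs_call :: "real \<Rightarrow> real \<Rightarrow> real \<Rightarrow> real \<Rightarrow> real" where
  "bs_call T F K v = F * N (d1 T F K v) - K * N (d2 T F K v)"

definition bs_put :: "real \<Rightarrow> real \<Rightarrow> real \<Rightarrow> real \<Rightarrow> real" where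
  "bs_put T F K v = K * N (- d2 T F K v) - F * N (- d1 T F K v)"

(* D and D2 are the first and second Frechet derivatives.  Continuity of D need not be
   required, since D is differentiable.  Only meant for open S. *)
definition twice_continuously_differentiable_on ::
    "('a::real_normed_vector \<Rightarrow> 'b::real_normed_vector) \<Rightarrow> 'a set \<Rightarrow> bool" where
  "twice_continuously_differentiable_on f S \<longleftrightarrow>
     (\<exists>(D :: 'a \<Rightarrow> 'a \<Rightarrow>\<^sub>L 'b) (D2 :: 'a \<Rightarrow> 'a \<Rightarrow>\<^sub>L ('a \<Rightarrow>\<^sub>L 'b)).
        (\<forall>x\<in>S. (f has_derivative blinfun_apply (D x)) (at x)) \<and>
        (\<forall>x\<in>S. (D has_derivative blinfun_apply (D2 x)) (at x)) \<and>
        continuous_on S D2)"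

(* The arguments of a smile s are, in this order, the strike K and the forward F;
   its values outside K > 0, F > 0 are irrelevant. *)
definition implied_vol_smile :: "(real \<Rightarrow> real \<Rightarrow> real) \<Rightarrow> bool" where
  "implied_vol_smile s \<longleftrightarrow>
     (\<forall>K>0. \<forall>F>0. s K F > 0) \<and>
     twice_continuously_differentiable_on (\<lambda>(K, F). s K F) ({0<..} \<times> {0<..})"

(* The integrands are nonnegative, so convergence of the (improper) integrals is
   Lebesgue integrability. *)
definition fair_variance_integrals_converge ::
    "real \<Rightarrow> (real \<Rightarrow> real \<Rightarrow> real) \<Rightarrow> real \<Rightarrow> bool" where
  "fair_variance_integrals_converge T s F \<longleftrightarrow>
     set_integrable lborel {0<..<F} (\<lambda>K. bs_put T F K (s K F) / K\<^sup>2) \<and>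
     set_integrable lborel {F<..} (\<lambda>K. bs_call T F K (s K F) / K\<^sup>2)"

definition fair_variance :: "real \<Rightarrow> (real \<Rightarrow> real \<Rightarrow> real) \<Rightarrow> real \<Rightarrow> real" where
  "fair_variance T s F =
     2 / T * (LBINT K:{0<..<F}. bs_put T F K (s K F) / K\<^sup>2) +
     2 / T * (LBINT K:{F<..}. bs_call T F K (s K F) / K\<^sup>2)"

end

theory Submission
  imports Defs
begin

text \<open>Both prices are homogeneous of degree one in (forward, strike), and the smile depends on
  \<^term>\<open>K / F\<close> only, so the substitution \<^term>\<open>K = F * k\<close> shows that the fair variance does
  not depend on the forward at all.\<close>

text \<open>The terms \<open>d1\<close> and \<open>d2\<close> see forward and strike only through
  \<open>F / K\<close>, so at fixed volatility a common factor \<open>c\<close> cancels there and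
  survives only in the two prefactors.\<close>

lemma bs_call_homogeneous:
  assumes "c > 0"
  shows "bs_call T (c * F) (c * K) v = c * bs_call T F K v"
  using assms by (simp add: bs_call_def d1_def d2_def algebra_simps)

lemma bs_put_homogeneous:
  assumes "c > 0"
  shows "bs_put T (c * F) (c * K) v = c * bs_put T F K v"
  using assms by (simp add: bs_put_def d1_def d2_def algebra_simps)

text \<open>Affine substitution with shift 0, applied to \<open>g\<close> times the indicator of
  \<open>A\<close>; the Jacobian is \<open>c\<close> itself because \<open>c > 0\<close>. For a
  non-integrable integrand both sides take the default value 0.\<close>

lemma set_lebesgue_integral_scale:
  fixes g :: "real \<Rightarrow> 'a :: {banach, second_countable_topology}"
  assumes "c > 0"
  shows "(LBINT x:A. g x) = c *\<^sub>R (LBINT x:{x. c * x \<in> A}. g (c * x))"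
  unfolding set_lebesgue_integral_def
  using lborel_integral_real_affine[of c "\<lambda>x. indicator A x *\<^sub>R g x" 0] assms
  by (simp add: indicator_def)

lemma fair_variance_eq_unit_forward:
  assumes "F > 0"
    and smile: "\<And>K F. K > 0 \<Longrightarrow> F > 0 \<Longrightarrow> s K F = \<sigma> (ln (K / F))"
  shows "fair_variance T s F = fair_variance T s 1"
proof -
  \<comment> \<open>Both points have log-moneyness \<open>ln k\<close>.\<close>
  have scale: "s (F * k) F = s k 1" if "k > 0" for k
    using that \<open>F > 0\<close> smile[of "F * k" F] smile[of k 1] by simp
  \<comment> \<open>The leading \<open>F\<close> is the Jacobian of \<open>K = F * k\<close>.
    Homogeneity supplies a second factor \<open>F\<close>, and together they cancel the square of
    \<open>F\<close> in the denominator.\<close>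
  have put: "F * (bs_put T F (F * k) (s (F * k) F) / (F * k)\<^sup>2) = bs_put T 1 k (s k 1) / k\<^sup>2"
    if "k > 0" for k
    using bs_put_homogeneous[of F T 1 k] scale[OF that] \<open>F > 0\<close> that
    by (simp add: power2_eq_square)
  have call: "F * (bs_call T F (F * k) (s (F * k) F) / (F * k)\<^sup>2) = bs_call T 1 k (s k 1) / k\<^sup>2"
    if "k > 0" for k
    using bs_call_homogeneous[of F T 1 k] scale[OF that] \<open>F > 0\<close> that
    by (simp add: power2_eq_square)
  \<comment> \<open>The boundary \<open>K = F\<close> between puts and calls moves to
    \<open>k = 1\<close>, so the integration ranges also lose their dependence on
    \<open>F\<close>.\<close>
  have sets: "{k. F * k \<in> {0<..<F}} = {0<..<1}" "{k. F * k \<in> {F<..}} = {1<..}"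
    using \<open>F > 0\<close> by (auto simp: zero_less_mult_iff)
  have "(LBINT K:{0<..<F}. bs_put T F K (s K F) / K\<^sup>2)
      = (LBINT k:{0<..<1}. F * (bs_put T F (F * k) (s (F * k) F) / (F * k)\<^sup>2))"
    unfolding set_lebesgue_integral_scale[OF \<open>F > 0\<close>, of "{0<..<F}"] sets
    by (simp only: set_integral_mult_right real_scaleR_def)
  also have "\<dots> = (LBINT k:{0<..<1}. bs_put T 1 k (s k 1) / k\<^sup>2)"
    by (intro set_lebesgue_integral_cong) (use put in auto)
  finally have puts: "(LBINT K:{0<..<F}. bs_put T F K (s K F) / K\<^sup>2) = \<dots>" .
  have "(LBINT K:{F<..}. bs_call T F K (s K F) / K\<^sup>2)
      = (LBINT k:{1<..}. F * (bs_call T F (F * k) (s (F * k) F) / (F * k)\<^sup>2))"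
    unfolding set_lebesgue_integral_scale[OF \<open>F > 0\<close>, of "{F<..}"] sets
    by (simp only: set_integral_mult_right real_scaleR_def)
  also have "\<dots> = (LBINT k:{1<..}. bs_call T 1 k (s k 1) / k\<^sup>2)"
    by (intro set_lebesgue_integral_cong) (use call in auto)
  finally have calls: "(LBINT K:{F<..}. bs_call T F K (s K F) / K\<^sup>2) = \<dots>" .
  show ?thesis
    unfolding fair_variance_def puts calls ..
qed

theorem corollary2p3:
  fixes T :: real and s :: "real \<Rightarrow> real \<Rightarrow> real" and \<sigma> :: "real \<Rightarrow> real"
  assumes "T > 0"
    and "implied_vol_smile s"
    and "\<And>F. F > 0 \<Longrightarrow> fair_variance_integrals_converge T s F"
    and "\<And>x. \<sigma> x > 0"
    and "\<And>K F. K > 0 \<Longrightarrow> F > 0 \<Longrightarrow> s K F = \<sigma> (ln (K / F))"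
  shows "\<forall>F>0. (fair_variance T s has_real_derivative 0) (at F)"
proof (intro allI impI)
  fix F :: real
  assume "F > 0"
  show "(fair_variance T s has_real_derivative 0) (at F)"
  \<comment> \<open>Constancy is known for positive forwards only; since \<open>{0<..}\<close> is an
    open neighbourhood of \<open>F\<close>, this suffices to transfer the zero derivative of a
    constant.\<close>
  proof (rule has_field_derivative_transform_within_open)
    show "((\<lambda>_. fair_variance T s 1) has_real_derivative 0) (at F)"
      by simp
    show "fair_variance T s 1 = fair_variance T s G" if "G \<in> {0<..}" for G
      using that fair_variance_eq_unit_forward[of G s \<sigma> T] assms(5) by simp
  qed (use \<open>F > 0\<close> in auto)
qed

end
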